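(* Let $n,c,r\in\mathbb{N}$, $\mathbf{q}=(q_1,\ldots,q_n)\in(0,1)^n$, and let $Y_1^{(c)},\ldots,Y_n^{(c)}$ be independent with $Y_j^{(c)}\sim\mathrm{NegBin}(c,q_j)$; put $Y_{n:n}^{(c)}=\max_jY_j^{(c)}$. Let $\tilde W_1^{(c)},\ldots,\tilde W_n^{(c)}$ be independent random variables supported on $[c,\infty)$, where $\tilde W_j^{(c)}$ has cumulative distribution function $w\mapsto I_{q_j}(c,w-c+1)\,\mathbf{1}_{\{w\ge c\}}$, and put $\tilde W_{n:n}^{(c)}=\max_j\tilde W_j^{(c)}$. Then $$\tilde\Psi_r(\mathbf{q})\le\mathbb{E}\bigl[(Y_{n:n}^{(c)})^r\bigr]\le\sum_{s=0}^{r}\binom{r}{s}\tilde\Psi_s(\mathbf{q}),$$ where $\tilde\Psi_s(\mathbf{q})=\mathbb{E}[(\tilde W_{n:n}^{(c)})^s]$ for integers $s\ge0$ (so $\tilde\Psi_0=1$), and for $s\ge 1$ $$\tilde\Psi_s(\mathbf{q})=c^s+\int_{c^s}^\infty\Bigl(1-\prod_{j=1}^n I_{q_j}\bigl(c,w^{1/s}-c+1\bigr)\Bigr)\,dw.$$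
   Context: $\mathbb{N}=\{1,2,\ldots\}$. $\mathrm{NegBin}(c,q)$ is the law of the sum of $c$ independent geometric random variables on $\{1,2,\ldots\}$ with success probability $q$ (the number of Bernoulli($q$) trials needed for $c$ successes). $I_x(a,b)=\int_0^x t^{a-1}(1-t)^{b-1}dt\big/\int_0^1 t^{a-1}(1-t)^{b-1}dt$ is the regularized incomplete beta function, for $a,b>0$ and $x\in(0,1)$. *)

theory Defs
  imports "HOL-Probability.Probability"
begin

text \<open>
  The library's \<open>geometric_pmf\<close> counts failures before the first success, so it lives on
  \<open>{0, 1, \<dots>}\<close>; mapping by \<open>Suc\<close> gives the number of trials, on \<open>{1, 2, \<dots>}\<close>.
  In the same way the law below is supported on \<open>{c, c + 1, \<dots>}\<close>, whereas the library's
  \<open>neg_binomial_pmf\<close> starts at \<open>0\<close>. The second argument \<open>0\<close> of \<open>Pi_pmf\<close> is only the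
  default value outside the index set.
\<close>
definition negbin_trials_pmf :: "nat \<Rightarrow> real \<Rightarrow> nat pmf" where
  "negbin_trials_pmf c q =
     map_pmf (\<lambda>g. \<Sum>i<c. g i) (Pi_pmf {..<c} 0 (\<lambda>_. map_pmf Suc (geometric_pmf q)))"

definition reg_inc_beta :: "real \<Rightarrow> real \<Rightarrow> real \<Rightarrow> real" where
  "reg_inc_beta x a b =
     (LBINT t:{0..x}. t powr (a - 1) * (1 - t) powr (b - 1)) /
     (LBINT t:{0..1}. t powr (a - 1) * (1 - t) powr (b - 1))"

end

(* The probability of at most K = m - c failures before the c-th success is a partial sum whose
   q-derivative telescopes to a multiple of q^(c-1) (1-q)^K. Hence
   P(Y_j <= m) = I_{q_j}(c, m-c+1) = P(W_j <= m) for every integer m, so the ceiling of max W_j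
   has the law of max Y_j. Everything then follows from x <= ceiling x <= x + 1, the binomial
   theorem, and the layer-cake formula for the moments of max W_j. *)
theory Submission
  imports Defs "HOL-Real_Asymp.Real_Asymp"
begin

section \<open>The negative binomial law in terms of failures\<close>

text \<open>Each of the \<open>c\<close> waiting times exceeds its number of failures by 1, so
  trials exceed failures by \<open>c\<close>. The induction splits off one waiting time, matching
  the recursion of \<open>neg_binomial_pmf\<close>, whose mass function has a closed form.\<close>

lemma negbin_trials_pmf_eq_neg_binomial_pmf:
  "negbin_trials_pmf c q = map_pmf (\<lambda>k. k + c) (neg_binomial_pmf c q)"
proof (induction c)
  case 0
  then show ?case by (simp add: negbin_trials_pmf_def)
next
  case (Suc c)
  let ?g = "map_pmf Suc (geometric_pmf q)"
  have "negbin_trials_pmf (Suc c) q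
      = map_pmf (\<lambda>(y, f). \<Sum>i<Suc c. (f(c := y)) i) (pair_pmf ?g (Pi_pmf {..<c} 0 (\<lambda>_. ?g)))"
    by (simp add: negbin_trials_pmf_def lessThan_Suc Pi_pmf_insert map_pmf_comp case_prod_unfold)
  \<comment> \<open>The sum over \<open>i < c\<close> ignores the update at \<open>c\<close>, so the
    map factors through the pair of the split-off waiting time and the sum of the others.\<close>
  also have "(\<lambda>(y, f). \<Sum>i<Suc c. (f(c := y)) i)
      = (\<lambda>(y :: nat, s). y + s) \<circ> (\<lambda>(y, f). (y, \<Sum>i<c. f i))"
    by (auto simp: fun_eq_iff intro!: sum.cong)
  also have "map_pmf \<dots> (pair_pmf ?g (Pi_pmf {..<c} 0 (\<lambda>_. ?g)))
      = map_pmf (\<lambda>(y, s). y + s) (pair_pmf ?g (negbin_trials_pmf c q))"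
    unfolding negbin_trials_pmf_def pair_map_pmf2
    by (simp add: map_pmf_comp o_def apsnd_def map_prod_def case_prod_unfold)
  also have "\<dots> = map_pmf (\<lambda>k. k + Suc c) (neg_binomial_pmf (Suc c) q)"
    by (simp add: Suc.IH neg_binomial_pmf_Suc pair_map_pmf1 pair_map_pmf2 map_pmf_comp
        case_prod_unfold add_ac)
  finally show ?case .
qed

section \<open>The incomplete beta function at integer parameters\<close>

text \<open>The negative part of the derivative of each new term merges with the derivative of the
  previous partial sum through x^d - x^(d+1) = x^d (1-x), so a single term survives. For d = c - 1
  the summands are the probabilities of k failures before success number c.\<close>

lemma DERIV_neg_binomial_partial_sum:
  fixes x :: real
  shows "((\<lambda>x. \<Sum>k\<le>K. real ((k + d) choose k) * x ^ Suc d * (1 - x) ^ k)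
    has_real_derivative real (Suc d) * real ((K + Suc d) choose K) * x ^ d * (1 - x) ^ K) (at x)"
proof (induction K)
  case 0
  have "((\<lambda>x::real. x ^ Suc d) has_real_derivative real (Suc d) * x ^ d) (at x)"
    by (rule derivative_eq_intros refl | simp)+
  then show ?case by simp
next
  case (Suc K)
  define C where "C = real (Suc (K + d) choose Suc K)"
  have "((\<lambda>x. C * x ^ Suc d * (1 - x) ^ Suc K) has_real_derivative
      C * (real (Suc d) * x ^ d * (1 - x) ^ Suc K - real (Suc K) * x ^ Suc d * (1 - x) ^ K)) (at x)"
    by (rule derivative_eq_intros refl | simp add: algebra_simps)+
  note D = DERIV_add[OF Suc.IH this]
  \<comment> \<open>Expresses the constant of the induction hypothesis through the coefficient
    \<open>C\<close> of the new term, which makes the merging visible; both sides equal (K+d+1)! /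
    (K! d!).\<close>
  have 1: "real (Suc d) * real ((K + Suc d) choose K) = real (Suc K) * C"
  proof -
    have "Suc K * (Suc (K + d) choose Suc K) = (Suc (K + d) - K) * (Suc (K + d) choose K)"
      by (metis Suc_diff_le binomial_absorb_comp binomial_absorption diff_Suc_Suc add_Suc_right
          le_add1 mult.commute Suc_times_binomial_add add.commute)
    then show ?thesis unfolding C_def of_nat_mult[symmetric] by (simp add: Suc_diff_le)
  qed
  \<comment> \<open>Merging leaves the coefficient (K+1) + (d+1) times \<open>C\<close>, which has
    to be the constant claimed for \<open>Suc K\<close>.\<close>
  have 2: "real (K + d + 2) * C = real (Suc d) * real ((Suc K + Suc d) choose Suc K)"
  proof -
    have "Suc (Suc (K + d)) * (Suc (K + d) choose d) = (Suc (Suc (K + d)) choose Suc d) * Suc d"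
      by (rule Suc_times_binomial_eq)
    moreover have "Suc (K + d) choose d = Suc (K + d) choose Suc K"
      by (subst binomial_symmetric) (auto simp: Suc_diff_le)
    moreover have "Suc (Suc (K + d)) choose Suc d = Suc (Suc (K + d)) choose Suc K"
      by (subst binomial_symmetric) (auto simp: Suc_diff_le)
    ultimately show ?thesis
      unfolding C_def of_nat_mult[symmetric] by (simp add: mult.commute del: binomial_Suc_Suc)
  qed
  have "real (Suc d) * real ((K + Suc d) choose K) * x ^ d * (1 - x) ^ K
      + C * (real (Suc d) * x ^ d * (1 - x) ^ Suc K - real (Suc K) * x ^ Suc d * (1 - x) ^ K)
      = real (K + d + 2) * C * x ^ d * (1 - x) ^ Suc K"
    unfolding 1 by (simp add: algebra_simps)
  also have "\<dots> = real (Suc d) * real ((Suc K + Suc d) choose Suc K) * x ^ d * (1 - x) ^ Suc K"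
    unfolding 2 ..
  finally show ?case
    using D unfolding C_def by (simp del: binomial_Suc_Suc power_Suc of_nat_Suc)
qed

text \<open>Dividing the partial sum by the constant of its derivative gives an antiderivative of
  the beta integrand; it vanishes at 0 because of the factor \<open>x ^ Suc d\<close>.\<close>

lemma set_lebesgue_integral_beta_powr_nat:
  fixes x :: real
  assumes "0 \<le> x" "x \<le> 1"
  shows "(LBINT t:{0..x}. t powr real d * (1 - t) powr real K)
    = (\<Sum>k\<le>K. real ((k + d) choose k) * x ^ Suc d * (1 - x) ^ k)
        / (real (Suc d) * real ((K + Suc d) choose K))"
    (is "_ = ?F x / ?C")
proof -
  have C: "?C > 0" by simp
  have "(LBINT t:{0..x}. t powr real d * (1 - t) powr real K) = (LBINT t:{0..x}. t ^ d * (1 - t) ^ K)"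
  proof (rule set_lebesgue_integral_cong_AE)
    \<comment> \<open>\<open>0 powr 0 = 0\<close> whereas \<open>0 ^ 0 = 1\<close>, so the
      integrands may differ at 0 and 1, which form a null set.\<close>
    show "AE t\<in>{0..x} in lborel. t powr real d * (1 - t) powr real K = t ^ d * (1 - t) ^ K"
      using AE_lborel_singleton[of 0] AE_lborel_singleton[of 1]
      by eventually_elim (use assms in \<open>auto simp: powr_realpow\<close>)
  qed auto
  also have "\<dots> = ?F x / ?C - ?F 0 / ?C"
  proof -
    have "(\<integral>t. t ^ d * (1 - t) ^ K * indicator {0..x} t \<partial>lborel) = ?F x / ?C - ?F 0 / ?C"
    proof (rule integral_FTC_Icc_real)
      show "((\<lambda>x. ?F x / ?C) has_real_derivative t ^ d * (1 - t) ^ K) (at t)" for t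
        using DERIV_cdivide[OF DERIV_neg_binomial_partial_sum[of d K t], of ?C] C
        by (simp del: binomial_Suc_Suc power_Suc of_nat_Suc)
    qed (use assms in auto)
    then show ?thesis
      by (simp add: set_lebesgue_integral_def mult.commute del: binomial_Suc_Suc power_Suc of_nat_Suc)
  qed
  finally show ?thesis by simp
qed

text \<open>The normalising integral is the same formula at 1, where only the term k = 0 survives
  and the sum is 1; the common constant cancels in the quotient.\<close>

lemma reg_inc_beta_nat:
  assumes "0 \<le> x" "x \<le> 1"
  shows "reg_inc_beta x (real (Suc d)) (real (Suc K))
    = (\<Sum>k\<le>K. real ((k + d) choose k) * x ^ Suc d * (1 - x) ^ k)"
proof -
  have "(\<Sum>k\<le>K. real ((k + d) choose k) * 1 ^ Suc d * (1 - 1) ^ k) = 1"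
    by (simp add: power_0_left sum.delta if_distrib cong: if_cong)
  moreover have exponents: "real (Suc d) - 1 = real d" "real (Suc K) - 1 = real K" by simp_all
  ultimately show ?thesis
    unfolding reg_inc_beta_def exponents
    using set_lebesgue_integral_beta_powr_nat[OF assms, of d K]
      set_lebesgue_integral_beta_powr_nat[of 1 d K]
    by (simp del: binomial_Suc_Suc power_Suc of_nat_Suc)
qed

section \<open>Distribution function and moments of the negative binomial law\<close>

text \<open>At most \<open>m\<close> trials means at most K = m - c failures, which is the partial
  sum above, and m - c + 1 is \<open>Suc K\<close>. For \<open>m < c\<close> this beta parameter is
  not positive, hence the separate value 0.\<close>

lemma measure_negbin_trials_pmf_atMost:
  assumes "0 < q" "q \<le> 1" "1 \<le> c"
  shows "measure (negbin_trials_pmf c q) {..m}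
    = (if c \<le> m then reg_inc_beta q (real c) (real m - real c + 1) else 0)"
proof (cases "c \<le> m")
  case True
  obtain d where d: "c = Suc d" using assms by (cases c) auto
  obtain K where K: "m = K + c" using True by (metis add.commute le_Suc_ex)
  have "measure (negbin_trials_pmf c q) {..m} = measure (neg_binomial_pmf c q) {..K}"
    unfolding negbin_trials_pmf_eq_neg_binomial_pmf measure_map_pmf
    by (rule arg_cong[where f = "measure _"]) (auto simp: K)
  also have "\<dots> = (\<Sum>k\<le>K. pmf (neg_binomial_pmf c q) k)"
    by (rule measure_measure_pmf_finite) simp
  also have "\<dots> = reg_inc_beta q (real c) (real (Suc K))"
    unfolding d using assms
    by (subst reg_inc_beta_nat) (auto simp: pmf_neg_binomial intro!: sum.cong)
  also have "real (Suc K) = real m - real c + 1" by (simp add: K)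
  finally show ?thesis using True by simp
next
  case False
  then have "(\<lambda>k. k + c) -` {..m} = {}" by auto
  with False show ?thesis
    by (simp add: negbin_trials_pmf_eq_neg_binomial_pmf measure_map_pmf)
qed

lemma summable_poly_times_geometric:
  fixes x :: real
  assumes "0 < x" "x < 1"
  shows "summable (\<lambda>k. real (k + c) ^ d * x ^ k)"
proof (rule summable_comparison_test_bigo)
  \<comment> \<open>The midpoint of x and 1 is a ratio large enough to absorb the polynomial factor
    and still below 1.\<close>
  show "summable (\<lambda>k. norm (((1 + x) / 2) ^ k))" using assms by simp
  show "(\<lambda>k. real (k + c) ^ d * x ^ k) \<in> O(\<lambda>k. ((1 + x) / 2) ^ k)"
  proof -
    have "x < (1 + x) / 2" using assms by simp
    then show ?thesis using assms by real_asymp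
  qed
qed

text \<open>The binomial coefficient in the mass function grows at most polynomially in k, so the
  moment series is dominated by a polynomial times (1-q)^k.\<close>

lemma integrable_negbin_trials_pmf_power:
  assumes "0 < q" "q < 1"
  shows "integrable (negbin_trials_pmf c q) (\<lambda>k. real k ^ s)"
proof -
  have *: "summable (\<lambda>k. pmf (neg_binomial_pmf c q) k * real (k + c) ^ s)"
  proof (rule summable_comparison_test')
    show "summable (\<lambda>k. real (k + c) ^ (c + s) * (1 - q) ^ k)"
      using assms by (intro summable_poly_times_geometric) auto
    fix k :: nat
    have "(k + c - 1) choose k \<le> (k + c) ^ c"
    proof (cases c)
      case (Suc d)
      have "(k + d) choose k = (k + d) choose d" by (subst binomial_symmetric) auto
      also have "\<dots> \<le> (k + d) ^ d" by (cases "d = 0") (auto intro!: binomial_le_pow)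
      also have "\<dots> \<le> (k + c) ^ d" by (intro power_mono) (auto simp: Suc)
      also have "\<dots> \<le> (k + c) ^ c" by (rule power_increasing) (auto simp: Suc)
      finally show ?thesis by (simp add: Suc)
    \<comment> \<open>For \<open>c = 0\<close> the subtraction truncates: the coefficient is 0 for k
      > 0, and both sides are 1 at k = 0.\<close>
    qed (cases k; simp add: binomial_eq_0)
    then have "real ((k + c - 1) choose k) * q ^ c \<le> real ((k + c) ^ c) * 1"
      using assms by (intro mult_mono power_le_one) (auto simp del: of_nat_power)
    then have "real ((k + c - 1) choose k) * q ^ c * ((1 - q) ^ k * real (k + c) ^ s)
        \<le> real ((k + c) ^ c) * ((1 - q) ^ k * real (k + c) ^ s)"
      using assms by (intro mult_right_mono) auto
    then show "norm (pmf (neg_binomial_pmf c q) k * real (k + c) ^ s) \<le> real (k + c) ^ (c + s) * (1 - q) ^ k"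
      using assms by (simp add: pmf_neg_binomial power_add abs_mult algebra_simps)
  qed
  show ?thesis
    unfolding negbin_trials_pmf_eq_neg_binomial_pmf
    using * by (simp only: integrable_map_pmf_eq)
      (simp add: measure_pmf_eq_density integrable_density integrable_count_space_nat_iff abs_mult)
qed

section \<open>Tail integrals and maxima of independent variables\<close>

text \<open>Layer-cake formula started at \<open>a\<close>: X - a is the length of the interval from
  \<open>a\<close> to X, and Fubini exchanges this length with the integral over
  \<open>M\<close>.\<close>

lemma (in prob_space) expectation_eq_integral_tail:
  assumes X: "integrable M X" and ge: "AE \<omega> in M. a \<le> X \<omega>"
  shows "set_integrable lborel {a..} (\<lambda>w. prob {\<omega>\<in>space M. w < X \<omega>})"
    and "expectation X = a + (LBINT w:{a..}. prob {\<omega>\<in>space M. w < X \<omega>})"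
proof -
  have [measurable]: "X \<in> borel_measurable M" using X by auto
  interpret P: pair_sigma_finite M lborel ..
  define T where "T = (\<lambda>w. prob {\<omega>\<in>space M. w < X \<omega>})"
  have [measurable]: "T \<in> borel_measurable borel"
  proof -
    \<comment> \<open>The tail probability is antitone, so its negative is monotone and hence Borel
      measurable.\<close>
    have "mono (\<lambda>w. - T w)"
      unfolding T_def by (auto intro!: monoI finite_measure_mono)
    then have "(\<lambda>w. - (- T w)) \<in> borel_measurable borel"
      by (intro borel_measurable_uminus borel_measurable_mono)
    then show ?thesis by simp
  qed
  define S where "S = {p. a \<le> snd p \<and> snd p < X (fst p)} \<inter> space (M \<Otimes>\<^sub>M lborel)"
  have [measurable]: "S \<in> sets (M \<Otimes>\<^sub>M lborel)" unfolding S_def by measurable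
  have ind: "indicator S (\<omega>, w) = (indicator {a..<X \<omega>} w :: ennreal)" if "\<omega> \<in> space M" for \<omega> w
    using that by (auto simp: S_def space_pair_measure indicator_def)
  \<comment> \<open>With nonnegative integrals the exchange rests on measurability of
    \<open>S\<close>; integrability of the tail then comes out of the finite value.\<close>
  have "ennreal (expectation X - a) = (\<integral>\<^sup>+\<omega>. ennreal (X \<omega> - a) \<partial>M)"
    using X ge by (subst nn_integral_eq_integral) (auto simp: prob_space)
  also have "\<dots> = (\<integral>\<^sup>+\<omega>. (\<integral>\<^sup>+w. indicator S (\<omega>, w) \<partial>lborel) \<partial>M)"
  proof (rule nn_integral_cong_AE)
    show "AE \<omega> in M. ennreal (X \<omega> - a) = (\<integral>\<^sup>+w. indicator S (\<omega>, w) \<partial>lborel)"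
      using ge AE_space by eventually_elim (simp add: ind)
  qed
  also have "\<dots> = (\<integral>\<^sup>+w. (\<integral>\<^sup>+\<omega>. indicator S (\<omega>, w) \<partial>M) \<partial>lborel)"
    by (rule P.Fubini'[symmetric]) simp
  also have "\<dots> = (\<integral>\<^sup>+w. ennreal (indicator {a..} w * T w) \<partial>lborel)"
  proof (rule nn_integral_cong)
    fix w :: real
    have "(\<integral>\<^sup>+\<omega>. indicator S (\<omega>, w) \<partial>M)
        = (\<integral>\<^sup>+\<omega>. indicator {a..} w * indicator {\<omega>\<in>space M. w < X \<omega>} \<omega> \<partial>M)"
      by (rule nn_integral_cong) (simp add: ind, simp add: indicator_def)
    also have "\<dots> = indicator {a..} w * emeasure M {\<omega>\<in>space M. w < X \<omega>}"
      by (subst nn_integral_cmult_indicator) auto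
    finally show "(\<integral>\<^sup>+\<omega>. indicator S (\<omega>, w) \<partial>M) = ennreal (indicator {a..} w * T w)"
      by (auto simp: T_def emeasure_eq_measure indicator_def)
  qed
  finally have eq: "(\<integral>\<^sup>+w. ennreal (indicator {a..} w * T w) \<partial>lborel) = ennreal (expectation X - a)" ..
  \<comment> \<open>\<open>ennreal\<close> sends negative reals to 0, so the return to real
    integrals uses that X - a has nonnegative expectation.\<close>
  have "a \<le> expectation X"
    using integral_mono_AE[of M "\<lambda>_. a" X] X ge by (simp add: prob_space)
  with eq have "integrable lborel (\<lambda>w. indicator {a..} w * T w)
      \<and> integral\<^sup>L lborel (\<lambda>w. indicator {a..} w * T w) = expectation X - a"
    by (subst (asm) nn_integral_eq_integrable) (auto simp: T_def)
  then show "set_integrable lborel {a..} (\<lambda>w. prob {\<omega>\<in>space M. w < X \<omega>})"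
    and "expectation X = a + (LBINT w:{a..}. prob {\<omega>\<in>space M. w < X \<omega>})"
    by (simp_all add: set_integrable_def set_lebesgue_integral_def T_def)
qed

lemma (in prob_space) cdf_Max_indep_vars:
  fixes X :: "'i \<Rightarrow> 'a \<Rightarrow> 'b :: {second_countable_topology, linorder_topology}"
  assumes "indep_vars (\<lambda>_. borel) X I" "finite I" "I \<noteq> {}"
  shows "prob {\<omega>\<in>space M. (MAX j\<in>I. X j \<omega>) \<le> x} = (\<Prod>j\<in>I. prob {\<omega>\<in>space M. X j \<omega> \<le> x})"
proof -
  have "prob (\<Inter>j\<in>I. X j -` {..x} \<inter> space M) = (\<Prod>j\<in>I. prob (X j -` {..x} \<inter> space M))"
    using assms by (intro indep_varsD_finite[of "\<lambda>_. borel"]) auto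
  moreover have "(\<Inter>j\<in>I. X j -` {..x} \<inter> space M) = {\<omega>\<in>space M. (MAX j\<in>I. X j \<omega>) \<le> x}"
    using assms by auto
  moreover have "X j -` {..x} \<inter> space M = {\<omega>\<in>space M. X j \<omega> \<le> x}" for j by auto
  ultimately show ?thesis by simp
qed

section \<open>Comparison of the two maxima\<close>

text \<open>The families live on separate spaces \<open>M\<close> and \<open>N\<close>, as the claim
  concerns their laws. Integrability is asserted too because the Bochner integral of a
  non-integrable function is 0, so the bare inequalities would not express finite moments.\<close>

theorem proposition7:
  fixes n c r :: nat
    and q :: "nat \<Rightarrow> real"
    and M :: "'a measure" and Y :: "nat \<Rightarrow> 'a \<Rightarrow> nat"
    and N :: "'b measure" and W :: "nat \<Rightarrow> 'b \<Rightarrow> real"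
  assumes "n \<ge> 1" and "c \<ge> 1" and "r \<ge> 1"
    and "\<And>j. j \<in> {1..n} \<Longrightarrow> 0 < q j \<and> q j < 1"
    and "prob_space M"
    and "prob_space.indep_vars M (\<lambda>_. count_space UNIV) Y {1..n}"
    and "\<And>j. j \<in> {1..n} \<Longrightarrow>
           distr M (count_space UNIV) (Y j) = measure_pmf (negbin_trials_pmf c (q j))"
    and "prob_space N"
    and "prob_space.indep_vars N (\<lambda>_. borel) W {1..n}"
    and "\<And>j. j \<in> {1..n} \<Longrightarrow> (AE \<omega> in N. real c \<le> W j \<omega>)"
    and "\<And>j w. j \<in> {1..n} \<Longrightarrow>
           cdf (distr N borel (W j)) w =
             (if w \<ge> real c then reg_inc_beta (q j) (real c) (w - real c + 1) else 0)"
  shows "integrable M (\<lambda>\<omega>. real (MAX j\<in>{1..n}. Y j \<omega>) ^ r)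
    \<and> (\<forall>s. integrable N (\<lambda>\<omega>. (MAX j\<in>{1..n}. W j \<omega>) ^ s))
    \<and> prob_space.expectation N (\<lambda>\<omega>. (MAX j\<in>{1..n}. W j \<omega>) ^ r)
        \<le> prob_space.expectation M (\<lambda>\<omega>. real (MAX j\<in>{1..n}. Y j \<omega>) ^ r)
    \<and> prob_space.expectation M (\<lambda>\<omega>. real (MAX j\<in>{1..n}. Y j \<omega>) ^ r)
        \<le> (\<Sum>s=0..r. real (r choose s) *
              prob_space.expectation N (\<lambda>\<omega>. (MAX j\<in>{1..n}. W j \<omega>) ^ s))
    \<and> prob_space.expectation N (\<lambda>\<omega>. (MAX j\<in>{1..n}. W j \<omega>) ^ 0) = 1
    \<and> (\<forall>s\<ge>1.
          set_integrable lborel {real c ^ s..}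
            (\<lambda>w. 1 - (\<Prod>j=1..n. reg_inc_beta (q j) (real c) (w powr (1 / real s) - real c + 1)))
        \<and> prob_space.expectation N (\<lambda>\<omega>. (MAX j\<in>{1..n}. W j \<omega>) ^ s) =
            real c ^ s +
            (LBINT w:{real c ^ s..}.
               1 - (\<Prod>j=1..n. reg_inc_beta (q j) (real c) (w powr (1 / real s) - real c + 1))))"
proof -
  interpret M: prob_space M by fact
  interpret N: prob_space N by fact
  note q = assms(4) and Yind = assms(6) and Y_law = assms(7) and Wind = assms(9)
    and W_ge = assms(10) and W_cdf = assms(11)
  define U where "U = (\<lambda>\<omega>. real (MAX j\<in>{1..n}. Y j \<omega>))"
  define V where "V = (\<lambda>\<omega>. MAX j\<in>{1..n}. W j \<omega>)"
  have ne: "{1..n} \<noteq> {}" using \<open>n \<ge> 1\<close> by auto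
  have Wm: "W j \<in> borel_measurable N" if "j \<in> {1..n}" for j
    using Wind that by (auto simp: N.indep_vars_def)
  have Ym: "Y j \<in> measurable M (count_space UNIV)" if "j \<in> {1..n}" for j
    using Yind that by (auto simp: M.indep_vars_def)
  have Vm[measurable]: "V \<in> borel_measurable N"
    unfolding V_def by (intro borel_measurable_Max Wm) auto
  have W_prob: "N.prob {\<omega>\<in>space N. W j \<omega> \<le> w}
      = (if w \<ge> real c then reg_inc_beta (q j) (real c) (w - real c + 1) else 0)"
    if "j \<in> {1..n}" for j w
    using W_cdf[OF that, of w] Wm[OF that]
    by (simp add: cdf_def measure_distr vimage_def Int_def conj_commute)
  have cdfs: "M.prob {\<omega>\<in>space M. Y j \<omega> \<le> m} = N.prob {\<omega>\<in>space N. W j \<omega> \<le> real m}"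
    if j: "j \<in> {1..n}" for j m
  proof -
    have "M.prob {\<omega>\<in>space M. Y j \<omega> \<le> m} = measure (distr M (count_space UNIV) (Y j)) {..m}"
      using Ym[OF j] by (simp add: measure_distr vimage_def Int_def conj_commute)
    also have "\<dots> = N.prob {\<omega>\<in>space N. W j \<omega> \<le> real m}"
      unfolding Y_law[OF j] W_prob[OF j]
      using q[OF j] \<open>c \<ge> 1\<close> by (subst measure_negbin_trials_pmf_atMost) auto
    finally show ?thesis .
  qed
  have Ymom: "integrable M (\<lambda>\<omega>. real (Y j \<omega>) ^ s)" if j: "j \<in> {1..n}" for j s
    using integrable_negbin_trials_pmf_power[of "q j" c s] q[OF j] Ym[OF j]
    by (simp add: integrable_distr_eq flip: Y_law[OF j])
  have "AE \<omega> in N. \<forall>j\<in>{1..n}. real c \<le> W j \<omega>"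
    using W_ge by (intro AE_finite_allI) auto
  then have Vge: "AE \<omega> in N. real c \<le> V \<omega>"
    by eventually_elim (use ne in \<open>auto simp: V_def Max_ge_iff\<close>)
  have Umax: "U = (\<lambda>\<omega>. MAX j\<in>{1..n}. real (Y j \<omega>))"
    unfolding U_def using ne by (simp add: mono_Max_commute[of real] monoI image_image)
  have Um[measurable]: "U \<in> borel_measurable M"
    unfolding Umax using Ym by (intro borel_measurable_Max) (auto intro: measurable_compose)
  \<comment> \<open>The maximum is attained at some index, so its power is one summand of a sum of
    nonnegative integrable powers.\<close>
  have Upow: "integrable M (\<lambda>\<omega>. U \<omega> ^ s)" for s
  proof (rule Bochner_Integration.integrable_bound)
    show "integrable M (\<lambda>\<omega>. \<Sum>j\<in>{1..n}. real (Y j \<omega>) ^ s)"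
      using Ymom by auto
    have "\<bar>U \<omega> ^ s\<bar> \<le> \<bar>\<Sum>j\<in>{1..n}. real (Y j \<omega>) ^ s\<bar>" for \<omega>
    proof -
      have "(MAX j\<in>{1..n}. Y j \<omega>) \<in> (\<lambda>j. Y j \<omega>) ` {1..n}"
        using ne by (intro Max_in) auto
      then obtain i where "i \<in> {1..n}" "U \<omega> = real (Y i \<omega>)"
        by (auto simp: U_def)
      then show ?thesis
        using member_le_sum[of i "{1..n}" "\<lambda>j. real (Y j \<omega>) ^ s"] by (auto simp: sum_nonneg)
    qed
    then show "AE \<omega> in M. norm (U \<omega> ^ s) \<le> norm (\<Sum>j\<in>{1..n}. real (Y j \<omega>) ^ s)" by simp
  qed simp
  \<comment> \<open>Restates independence with \<open>borel\<close>, the form in which the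
    distribution function of a maximum is computed.\<close>
  have Yind': "M.indep_vars (\<lambda>_. borel) Y {1..n}"
    using M.indep_vars_compose2[OF Yind, of "\<lambda>_ y. y" "\<lambda>_. borel"] by simp
  have UV: "M.prob {\<omega>\<in>space M. U \<omega> \<le> real m} = N.prob {\<omega>\<in>space N. V \<omega> \<le> real m}" for m
    using M.cdf_Max_indep_vars[OF Yind' _ ne, of m] N.cdf_Max_indep_vars[OF Wind _ ne, of "real m"] cdfs
    by (simp add: U_def V_def)
  \<comment> \<open>Both variables take integer values, so their distribution functions are
    determined at integers, where \<open>UV\<close> compares them.\<close>
  have law: "distr M borel U = distr N borel (\<lambda>\<omega>. real_of_int \<lceil>V \<omega>\<rceil>)"
  proof (rule cdf_unique)
    show "cdf (distr M borel U) = cdf (distr N borel (\<lambda>\<omega>. real_of_int \<lceil>V \<omega>\<rceil>))"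
    proof
      fix x :: real
      have L: "cdf (distr M borel U) x = M.prob {\<omega>\<in>space M. U \<omega> \<le> x}"
        by (simp add: cdf_def measure_distr vimage_def Int_def conj_commute)
      have R: "cdf (distr N borel (\<lambda>\<omega>. real_of_int \<lceil>V \<omega>\<rceil>)) x = N.prob {\<omega>\<in>space N. \<lceil>V \<omega>\<rceil> \<le> \<lfloor>x\<rfloor>}"
        by (simp add: cdf_def measure_distr vimage_def Int_def conj_commute le_floor_iff)
      show "cdf (distr M borel U) x = cdf (distr N borel (\<lambda>\<omega>. real_of_int \<lceil>V \<omega>\<rceil>)) x"
      proof (cases "x < 0")
        \<comment> \<open>\<open>UV\<close> speaks of natural numbers; below 0 both functions
          vanish, as \<open>U\<close> is nonnegative and \<open>V\<close> is almost surely at least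
          \<open>c\<close>.\<close>
        case True
        have "{\<omega>\<in>space M. U \<omega> \<le> x} = {}" using True by (auto simp: U_def)
        moreover have "N.prob {\<omega>\<in>space N. \<lceil>V \<omega>\<rceil> \<le> \<lfloor>x\<rfloor>} = 0"
        proof -
          have "AE \<omega> in N. \<not> \<lceil>V \<omega>\<rceil> \<le> \<lfloor>x\<rfloor>"
            using Vge by eventually_elim (use True in \<open>simp add: ceiling_le_iff not_le, linarith\<close>)
          then show ?thesis by (subst N.prob_eq_0) auto
        qed
        ultimately show ?thesis by (metis L R measure_empty)
      next
        case False
        define m where "m = nat \<lfloor>x\<rfloor>"
        have m: "real m = real_of_int \<lfloor>x\<rfloor>" using False by (simp add: m_def)
        have "U \<omega> \<le> x \<longleftrightarrow> U \<omega> \<le> real m" for \<omega>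
          unfolding U_def m by (metis le_floor_iff of_int_le_iff of_int_of_nat_eq)
        then show ?thesis unfolding L R by (simp add: ceiling_le_iff UV flip: m)
      qed
    qed
  qed auto

  \<comment> \<open>Moment bounds by rounding up\<close>
  define Z where "Z = (\<lambda>\<omega>. real_of_int \<lceil>V \<omega>\<rceil>)"
  have Zm[measurable]: "Z \<in> borel_measurable N" unfolding Z_def by measurable
  \<comment> \<open>Integrability passes from \<open>U\<close> to \<open>Z\<close> through the
    common law, and later from \<open>Z\<close> to \<open>V\<close> by domination.\<close>
  have Zpow: "integrable N (\<lambda>\<omega>. Z \<omega> ^ s)"
    and UZ: "M.expectation (\<lambda>\<omega>. U \<omega> ^ s) = N.expectation (\<lambda>\<omega>. Z \<omega> ^ s)" for s
    using Upow[of s] integrable_distr_eq[of U M borel "\<lambda>x. x ^ s"]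
      integrable_distr_eq[of Z N borel "\<lambda>x. x ^ s"]
      integral_distr[of U M borel "\<lambda>x. x ^ s"] integral_distr[of Z N borel "\<lambda>x. x ^ s"]
    by (simp_all add: law Z_def)
  \<comment> \<open>Positivity of \<open>V\<close>, from \<open>c >= 1\<close>, allows the rounding
    inequalities to be raised to powers.\<close>
  have bounds: "AE \<omega> in N. 0 < V \<omega> \<and> V \<omega> \<le> Z \<omega> \<and> Z \<omega> \<le> V \<omega> + 1"
    using Vge by eventually_elim (use \<open>c \<ge> 1\<close> in \<open>auto simp: Z_def\<close>)
  have Vpow: "integrable N (\<lambda>\<omega>. V \<omega> ^ s)" for s
  proof (rule Bochner_Integration.integrable_bound[OF Zpow])
    show "AE \<omega> in N. norm (V \<omega> ^ s) \<le> norm (Z \<omega> ^ s)"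
      using bounds by eventually_elim (auto intro!: power_mono simp: power_abs)
  qed simp
  have lower: "N.expectation (\<lambda>\<omega>. V \<omega> ^ r) \<le> N.expectation (\<lambda>\<omega>. Z \<omega> ^ r)"
  proof (rule integral_mono_AE[OF Vpow Zpow])
    show "AE \<omega> in N. V \<omega> ^ r \<le> Z \<omega> ^ r"
      using bounds by eventually_elim (auto intro!: power_mono)
  qed
  have binom: "(V \<omega> + 1) ^ r = (\<Sum>s=0..r. real (r choose s) * V \<omega> ^ s)" for \<omega>
    by (simp add: binomial_ring atMost_atLeast0)
  have "N.expectation (\<lambda>\<omega>. Z \<omega> ^ r) \<le> N.expectation (\<lambda>\<omega>. (V \<omega> + 1) ^ r)"
  proof (rule integral_mono_AE[OF Zpow])
    show "integrable N (\<lambda>\<omega>. (V \<omega> + 1) ^ r)" unfolding binom using Vpow by auto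
    show "AE \<omega> in N. Z \<omega> ^ r \<le> (V \<omega> + 1) ^ r"
      using bounds by eventually_elim (auto intro!: power_mono)
  qed
  also have "\<dots> = (\<Sum>s=0..r. real (r choose s) * N.expectation (\<lambda>\<omega>. V \<omega> ^ s))"
    unfolding binom using Vpow by (subst Bochner_Integration.integral_sum) auto
  finally have upper: "N.expectation (\<lambda>\<omega>. Z \<omega> ^ r)
      \<le> (\<Sum>s=0..r. real (r choose s) * N.expectation (\<lambda>\<omega>. V \<omega> ^ s))" .

  \<comment> \<open>Integral formula for the moments of the continuous maximum\<close>
  let ?G = "\<lambda>s w. 1 - (\<Prod>j=1..n. reg_inc_beta (q j) (real c) (w powr (1 / real s) - real c + 1))"
  have tail: "set_integrable lborel {real c ^ s..} (?G s) \<and>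
      N.expectation (\<lambda>\<omega>. V \<omega> ^ s) = real c ^ s + (LBINT w:{real c ^ s..}. ?G s w)"
    if "s \<ge> 1" for s
  proof -
    have G: "N.prob {\<omega>\<in>space N. w < V \<omega> ^ s} = ?G s w" if w: "w \<in> {real c ^ s..}" for w
    proof -
      define y where "y = w powr (1 / real s)"
      have "0 < real c ^ s" using \<open>c \<ge> 1\<close> by simp
      then have "0 < w" using w by (simp only: atLeast_iff)
      then have yw: "y ^ s = w" and "0 < y"
        using \<open>s \<ge> 1\<close> by (simp_all add: y_def powr_powr flip: powr_realpow)
      \<comment> \<open>From c^s <= w the root \<open>y\<close> is at least \<open>c\<close>, so
        every distribution function in \<open>W_prob\<close> takes its beta branch at
        \<open>y\<close>.\<close>
      then have y: "real c \<le> y"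
        using w \<open>s \<ge> 1\<close> by (metis atLeast_iff less_eq_real_def linorder_not_less power_strict_mono
            of_nat_0_le_iff not_one_le_zero neq0_conv)
      \<comment> \<open>The events agree only almost surely: where \<open>V\<close> is negative, an
        even power could exceed \<open>w\<close>.\<close>
      have "N.prob {\<omega>\<in>space N. w < V \<omega> ^ s} = N.prob {\<omega>\<in>space N. \<not> V \<omega> \<le> y}"
      proof (rule N.finite_measure_eq_AE)
        show "AE \<omega> in N. \<omega> \<in> {\<omega>\<in>space N. w < V \<omega> ^ s} \<longleftrightarrow> \<omega> \<in> {\<omega>\<in>space N. \<not> V \<omega> \<le> y}"
          using bounds
        proof eventually_elim
          case (elim \<omega>)
          then show ?case
            using power_less_imp_less_base[of y s "V \<omega>"] power_strict_mono[of y "V \<omega>" s]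
              \<open>0 < y\<close> \<open>s \<ge> 1\<close> by (auto simp flip: yw)
        qed
      qed auto
      also have "\<dots> = 1 - N.prob {\<omega>\<in>space N. V \<omega> \<le> y}"
        by (rule N.prob_neg) auto
      also have "N.prob {\<omega>\<in>space N. V \<omega> \<le> y}
          = (\<Prod>j=1..n. reg_inc_beta (q j) (real c) (y - real c + 1))"
        unfolding V_def using W_prob y
        by (subst N.cdf_Max_indep_vars[OF Wind _ ne]) (auto intro!: prod.cong)
      finally show ?thesis unfolding y_def .
    qed
    have "AE \<omega> in N. real c ^ s \<le> V \<omega> ^ s"
      using Vge by eventually_elim (auto intro!: power_mono)
    note N.expectation_eq_integral_tail[OF Vpow this]
    moreover have "set_integrable lborel {real c ^ s..} (\<lambda>w. N.prob {\<omega>\<in>space N. w < V \<omega> ^ s})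
        = set_integrable lborel {real c ^ s..} (?G s)"
      by (rule set_integrable_cong) (simp_all add: G)
    moreover have "(LBINT w:{real c ^ s..}. N.prob {\<omega>\<in>space N. w < V \<omega> ^ s})
        = (LBINT w:{real c ^ s..}. ?G s w)"
      by (rule set_lebesgue_integral_cong) (auto simp: G)
    ultimately show ?thesis by simp
  qed
  show ?thesis
    using Upow[of r] Vpow lower upper tail
    unfolding UZ[of r, symmetric] U_def V_def by (simp add: N.prob_space)
qed

end
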